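(* Let $R$ be a strongly $\sqrt{J}$-clean ring and let $n\ge 1$ be an integer. Then the matrix ring $M_n(R)$ is a strongly $\sqrt{J}$-clean ring if and only if $n=1$.
   Context: Rings are associative with identity $1\neq 0$ (not necessarily commutative). $J(R)$ is the Jacobson radical of $R$, and $\sqrt{J(R)}=\{z\in R : z^k\in J(R)\text{ for some } k\ge 1\}$. A ring $R$ is strongly $\sqrt{J}$-clean if every $x\in R$ can be written as $x=e+z$ with $e$ an idempotent of $R$, $z\in\sqrt{J(R)}$ and $ez=ze$. $M_n(R)$ is the ring of all $n\times n$ matrices over $R$. *)

theory Defs
  imports "HOL-Algebra.Ideal" "Jordan_Normal_Form.Matrix"
begin

text \<open>The ideals of HOL-Algebra are two-sided. For noncommutative rings the Jacobson radical
  is the intersection of the maximal \<^emph>\<open>left\<close> ideals.\<close>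

locale left_ideal = additive_subgroup I R + ring R for I and R (structure) +
  assumes l_closed: "\<lbrakk>a \<in> I; x \<in> carrier R\<rbrakk> \<Longrightarrow> x \<otimes> a \<in> I"

locale maximal_left_ideal = left_ideal +
  assumes I_notcarr: "carrier R \<noteq> I"
    and I_maximal: "\<lbrakk>left_ideal J R; I \<subseteq> J; J \<subseteq> carrier R\<rbrakk> \<Longrightarrow> J = I \<or> J = carrier R"

definition jacobson_radical :: "('a, 'b) ring_scheme \<Rightarrow> 'a set" where
  "jacobson_radical R = {x \<in> carrier R. \<forall>I. maximal_left_ideal I R \<longrightarrow> x \<in> I}"

definition sqrt_jacobson_radical :: "('a, 'b) ring_scheme \<Rightarrow> 'a set" where
  "sqrt_jacobson_radical R =
     {z \<in> carrier R. \<exists>k::nat. k \<ge> 1 \<and> z [^]\<^bsub>R\<^esub> k \<in> jacobson_radical R}"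

locale strongly_sqrtJ_clean_ring = ring R for R (structure) +
  assumes one_not_zero: "\<one> \<noteq> \<zero>"
    and strongly_clean: "x \<in> carrier R \<Longrightarrow>
      \<exists>e\<in>carrier R. \<exists>z\<in>sqrt_jacobson_radical R.
        x = e \<oplus> z \<and> e \<otimes> e = e \<and> e \<otimes> z = z \<otimes> e"

text \<open>The type of matrices is the one of the library, but its arithmetic (and hence
  \<^const>\<open>ring_mat\<close>) uses type class operations; here the entries lie in the carrier of an
  arbitrary ring \<open>R\<close>, and all operations are those of \<open>R\<close>.\<close>

definition matrix_ring :: "('a, 'b) ring_scheme \<Rightarrow> nat \<Rightarrow> 'a mat ring" where
  "matrix_ring R n = \<lparr>
     carrier = {A \<in> carrier_mat n n. \<forall>i<n. \<forall>j<n. A $$ (i, j) \<in> carrier R},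
     monoid.mult = (\<lambda>A B. mat n n (\<lambda>(i, j). \<Oplus>\<^bsub>R\<^esub>k\<in>{..<n}. A $$ (i, k) \<otimes>\<^bsub>R\<^esub> B $$ (k, j))),
     one = mat n n (\<lambda>(i, j). if i = j then \<one>\<^bsub>R\<^esub> else \<zero>\<^bsub>R\<^esub>),
     zero = mat n n (\<lambda>(i, j). \<zero>\<^bsub>R\<^esub>),
     add = (\<lambda>A B. mat n n (\<lambda>(i, j). A $$ (i, j) \<oplus>\<^bsub>R\<^esub> B $$ (i, j)))\<rparr>"

lemma ring_matrix_ring:
  fixes R (structure)
  assumes "ring R"
  shows "ring (matrix_ring R n)"
proof -
  interpret ring R by fact
  have unit_sum_l: "(\<Oplus>k\<in>{..<n}. mat n n (\<lambda>(i, j). if i = j then \<one> else \<zero>) $$ (i, k) \<otimes> f k) = f i"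
    if "i < n" "\<And>k. k < n \<Longrightarrow> f k \<in> carrier R" for i f
  proof -
    have "(\<Oplus>k\<in>{..<n}. mat n n (\<lambda>(i, j). if i = j then \<one> else \<zero>) $$ (i, k) \<otimes> f k)
        = (\<Oplus>k\<in>{..<n}. if i = k then f k else \<zero>)"
      using that by (intro finsum_cong') auto
    also have "\<dots> = f i"
      using that by (intro finsum_singleton) auto
    finally show ?thesis .
  qed
  have unit_sum_r: "(\<Oplus>k\<in>{..<n}. f k \<otimes> mat n n (\<lambda>(i, j). if i = j then \<one> else \<zero>) $$ (k, j)) = f j"
    if "j < n" "\<And>k. k < n \<Longrightarrow> f k \<in> carrier R" for j f
  proof -
    have "(\<Oplus>k\<in>{..<n}. f k \<otimes> mat n n (\<lambda>(i, j). if i = j then \<one> else \<zero>) $$ (k, j))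
        = (\<Oplus>k\<in>{..<n}. if j = k then f k else \<zero>)"
      using that by (intro finsum_cong') auto
    also have "\<dots> = f j"
      using that by (intro finsum_singleton) auto
    finally show ?thesis .
  qed
  have assoc: "(\<Oplus>k\<in>{..<n}. (\<Oplus>l\<in>{..<n}. a l \<otimes> b l k) \<otimes> c k)
      = (\<Oplus>l\<in>{..<n}. a l \<otimes> (\<Oplus>k\<in>{..<n}. b l k \<otimes> c k))"
    if a: "\<And>l. l < n \<Longrightarrow> a l \<in> carrier R"
      and b: "\<And>l k. l < n \<Longrightarrow> k < n \<Longrightarrow> b l k \<in> carrier R"
      and c: "\<And>k. k < n \<Longrightarrow> c k \<in> carrier R" for a b c
  proof -
    have "(\<Oplus>k\<in>{..<n}. (\<Oplus>l\<in>{..<n}. a l \<otimes> b l k) \<otimes> c k)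
        = (\<Oplus>k\<in>{..<n}. \<Oplus>l\<in>{..<n}. (a l \<otimes> b l k) \<otimes> c k)"
      using a b c by (intro finsum_cong' finsum_ldistr) auto
    also have "\<dots> = (\<Oplus>l\<in>{..<n}. \<Oplus>k\<in>{..<n}. (a l \<otimes> b l k) \<otimes> c k)"
      using a b c by (intro finsum_finsum_swap) auto
    also have "\<dots> = (\<Oplus>l\<in>{..<n}. \<Oplus>k\<in>{..<n}. a l \<otimes> (b l k \<otimes> c k))"
      using a b c by (intro finsum_cong') (auto simp: m_assoc)
    also have "\<dots> = (\<Oplus>l\<in>{..<n}. a l \<otimes> (\<Oplus>k\<in>{..<n}. b l k \<otimes> c k))"
      using a b c by (intro finsum_cong' finsum_rdistr[symmetric]) auto
    finally show ?thesis .
  qed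
  have assoc_mat: "(\<Oplus>k\<in>{..<n}. mat n n (\<lambda>(i, j). \<Oplus>l\<in>{..<n}. A $$ (i, l) \<otimes> B $$ (l, j)) $$ (i, k) \<otimes> C $$ (k, j))
      = (\<Oplus>l\<in>{..<n}. A $$ (i, l) \<otimes> mat n n (\<lambda>(i, j). \<Oplus>k\<in>{..<n}. B $$ (i, k) \<otimes> C $$ (k, j)) $$ (l, j))"
    (is "?l = ?r")
    if ij: "i < n" "j < n"
      and A: "\<forall>i<n. \<forall>j<n. A $$ (i, j) \<in> carrier R"
      and B: "\<forall>i<n. \<forall>j<n. B $$ (i, j) \<in> carrier R"
      and C: "\<forall>i<n. \<forall>j<n. C $$ (i, j) \<in> carrier R" for A B C i j
  proof -
    have "?l = (\<Oplus>k\<in>{..<n}. (\<Oplus>l\<in>{..<n}. A $$ (i, l) \<otimes> B $$ (l, k)) \<otimes> C $$ (k, j))"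
      using ij A B C by (intro finsum_cong') (auto intro!: finsum_closed)
    also have "\<dots> = (\<Oplus>l\<in>{..<n}. A $$ (i, l) \<otimes> (\<Oplus>k\<in>{..<n}. B $$ (l, k) \<otimes> C $$ (k, j)))"
      using ij A B C by (intro assoc) auto
    also have "\<dots> = ?r"
      using ij A B C by (intro finsum_cong') (auto intro!: finsum_closed)
    finally show ?thesis .
  qed
  have neg: "\<exists>B\<in>carrier (matrix_ring R n). B \<oplus>\<^bsub>matrix_ring R n\<^esub> A = \<zero>\<^bsub>matrix_ring R n\<^esub>"
    if "A \<in> carrier (matrix_ring R n)" for A
    using that
    by (intro bexI[of _ "mat n n (\<lambda>(i, j). \<ominus> A $$ (i, j))"])
       (auto simp: matrix_ring_def l_neg)
  have ldist: "(\<Oplus>k\<in>{..<n}. mat n n (\<lambda>(i, j). A $$ (i, j) \<oplus> B $$ (i, j)) $$ (i, k) \<otimes> c k)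
      = (\<Oplus>k\<in>{..<n}. A $$ (i, k) \<otimes> c k) \<oplus> (\<Oplus>k\<in>{..<n}. B $$ (i, k) \<otimes> c k)"
    if "i < n" "\<And>k. k < n \<Longrightarrow> A $$ (i, k) \<in> carrier R" "\<And>k. k < n \<Longrightarrow> B $$ (i, k) \<in> carrier R"
      "\<And>k. k < n \<Longrightarrow> c k \<in> carrier R" for A B c i
  proof -
    have "(\<Oplus>k\<in>{..<n}. mat n n (\<lambda>(i, j). A $$ (i, j) \<oplus> B $$ (i, j)) $$ (i, k) \<otimes> c k) = (\<Oplus>k\<in>{..<n}. A $$ (i, k) \<otimes> c k \<oplus> B $$ (i, k) \<otimes> c k)"
      using that by (intro finsum_cong') (auto simp: l_distr)
    also have "\<dots> = (\<Oplus>k\<in>{..<n}. A $$ (i, k) \<otimes> c k) \<oplus> (\<Oplus>k\<in>{..<n}. B $$ (i, k) \<otimes> c k)"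
      using that by (intro finsum_addf) auto
    finally show ?thesis .
  qed
  have rdist: "(\<Oplus>k\<in>{..<n}. c k \<otimes> mat n n (\<lambda>(i, j). A $$ (i, j) \<oplus> B $$ (i, j)) $$ (k, j))
      = (\<Oplus>k\<in>{..<n}. c k \<otimes> A $$ (k, j)) \<oplus> (\<Oplus>k\<in>{..<n}. c k \<otimes> B $$ (k, j))"
    if "j < n" "\<And>k. k < n \<Longrightarrow> A $$ (k, j) \<in> carrier R" "\<And>k. k < n \<Longrightarrow> B $$ (k, j) \<in> carrier R"
      "\<And>k. k < n \<Longrightarrow> c k \<in> carrier R" for A B c j
  proof -
    have "(\<Oplus>k\<in>{..<n}. c k \<otimes> mat n n (\<lambda>(i, j). A $$ (i, j) \<oplus> B $$ (i, j)) $$ (k, j)) = (\<Oplus>k\<in>{..<n}. c k \<otimes> A $$ (k, j) \<oplus> c k \<otimes> B $$ (k, j))"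
      using that by (intro finsum_cong') (auto simp: r_distr)
    also have "\<dots> = (\<Oplus>k\<in>{..<n}. c k \<otimes> A $$ (k, j)) \<oplus> (\<Oplus>k\<in>{..<n}. c k \<otimes> B $$ (k, j))"
      using that by (intro finsum_addf) auto
    finally show ?thesis .
  qed
  show ?thesis
  proof (rule ringI)
    show "abelian_group (matrix_ring R n)"
      by (rule abelian_groupI)
         (use neg in \<open>auto simp: matrix_ring_def a_assoc intro!: eq_matI a_comm\<close>)
    show "monoid (matrix_ring R n)"
    proof (rule monoidI)
      fix A B C
      assume "A \<in> carrier (matrix_ring R n)" "B \<in> carrier (matrix_ring R n)"
        "C \<in> carrier (matrix_ring R n)"
      then show "A \<otimes>\<^bsub>matrix_ring R n\<^esub> B \<otimes>\<^bsub>matrix_ring R n\<^esub> C =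
          A \<otimes>\<^bsub>matrix_ring R n\<^esub> (B \<otimes>\<^bsub>matrix_ring R n\<^esub> C)"
        by (auto simp: matrix_ring_def intro!: eq_matI assoc_mat)
    qed (auto simp: matrix_ring_def unit_sum_l unit_sum_r intro!: eq_matI finsum_closed)
  qed (auto simp: matrix_ring_def ldist rdist intro!: eq_matI)
qed

lemma matrix_ring_one_not_zero:
  assumes "\<one>\<^bsub>R\<^esub> \<noteq> \<zero>\<^bsub>R\<^esub>" and "n \<ge> 1"
  shows "\<one>\<^bsub>matrix_ring R n\<^esub> \<noteq> \<zero>\<^bsub>matrix_ring R n\<^esub>"
proof
  assume "\<one>\<^bsub>matrix_ring R n\<^esub> = \<zero>\<^bsub>matrix_ring R n\<^esub>"
  then have "\<one>\<^bsub>matrix_ring R n\<^esub> $$ (0, 0) = \<zero>\<^bsub>matrix_ring R n\<^esub> $$ (0, 0)"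
    by simp
  with assms show False
    by (simp add: matrix_ring_def)
qed

end

theory Submission
  imports Defs "HOL-Algebra.RingHom"
begin

text \<open>
  Two observations carry the proof. The Jacobson radical contains no idempotent other than \<open>\<zero>\<close>: if
  \<open>f \<noteq> \<zero>\<close> is idempotent then the left ideal \<open>R(\<one> - f)\<close> is proper, so it lies in a maximal left
  ideal, and that one cannot contain \<open>f\<close> as well (\<open>idempotent_in_jacobson_radical\<close>). Hence
  in a strongly \<open>\<surd>J\<close>-clean ring the idempotent part of a unit \<open>u\<close> is \<open>\<one>\<close>: if \<open>u = e + z\<close>
  with \<open>z\<^sup>k\<close> in the radical, then \<open>f = \<one> - e\<close> satisfies \<open>f u = f z\<close>, so \<open>f = u\<^sup>-\<^sup>k f z\<^sup>k\<close> is in the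
  radical and vanishes. So some power of \<open>u - \<one>\<close> is in the radical (\<open>unit_minus_one_in_sqrtJ\<close>).

  For \<open>n \<ge> 2\<close> this is violated by a unit coming from the \<open>2 \<times> 2\<close> matrix \<open>y\<close> with rows \<open>(0, 1)\<close> and
  \<open>(1, -1)\<close>. Since \<open>y\<^sup>2 + y = 1\<close>, both \<open>y\<close> and \<open>1 + y\<close> are invertible; so \<open>1 + y\<close> is a unit that
  differs from \<open>1\<close> by another unit. Placing \<open>y\<close> in the upper left corner of an \<open>n \<times> n\<close>
  zero matrix gives \<open>y\<^sup>2 + y = E\<close> with \<open>E\<close> the identity of the corner. Then \<open>\<one> + y\<close> is still a
  unit, and if a power of \<open>y\<close> lay in the radical, so would the nonzero idempotent \<open>E\<close>.

  For \<open>n = 1\<close> the matrix ring is a homomorphic image of \<open>R\<close>, and strong \<open>\<surd>J\<close>-cleanness passes to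
  nonzero homomorphic images because a preimage of a maximal left ideal is a maximal left ideal.
\<close>

section \<open>Left ideals and the Jacobson radical\<close>

lemma (in left_ideal) left_ideal_closed:
  shows "I \<subseteq> carrier R" and "\<zero> \<in> I"
    and "\<And>a b. a \<in> I \<Longrightarrow> b \<in> I \<Longrightarrow> a \<oplus> b \<in> I"
    and "\<And>a x. a \<in> I \<Longrightarrow> x \<in> carrier R \<Longrightarrow> x \<otimes> a \<in> I"
  by (fact a_subset additive_subgroup.zero_closed[OF is_additive_subgroup]
      additive_subgroup.a_closed[OF is_additive_subgroup] l_closed)+

context ring
begin

lemma left_idealI:
  assumes "I \<subseteq> carrier R" "\<zero> \<in> I"
    and "\<And>a b. a \<in> I \<Longrightarrow> b \<in> I \<Longrightarrow> a \<oplus> b \<in> I"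
    and "\<And>a x. a \<in> I \<Longrightarrow> x \<in> carrier R \<Longrightarrow> x \<otimes> a \<in> I"
  shows "left_ideal I R"
proof (intro left_ideal.intro left_ideal_axioms.intro additive_subgroup.intro ring_axioms)
  show "subgroup I (add_monoid R)"
  proof (rule add.subgroupI)
    fix a assume a: "a \<in> I"
    then have "\<ominus> a = (\<ominus> \<one>) \<otimes> a"
      using assms(1) by (auto simp: l_minus)
    then show "\<ominus> a \<in> I"
      using a assms(4) by simp
  qed (use assms in auto)
qed (use assms in auto)

lemma left_ideal_eq_carrier_iff:
  assumes "left_ideal I R"
  shows "I = carrier R \<longleftrightarrow> \<one> \<in> I"
proof
  assume one: "\<one> \<in> I"
  have "x \<in> I" if "x \<in> carrier R" for x
    using left_ideal.left_ideal_closed(4)[OF assms one that] that by simp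
  then show "I = carrier R"
    using left_ideal.left_ideal_closed(1)[OF assms] by auto
qed simp

lemma left_ideal_Union_chain:
  assumes "C \<noteq> {}" and chain: "subset.chain A C" and "\<And>I. I \<in> A \<Longrightarrow> left_ideal I R"
  shows "left_ideal (\<Union> C) R"
proof -
  have ideal: "left_ideal I R" if "I \<in> C" for I
    using that assms unfolding subset.chain_def by auto
  show ?thesis
  proof (rule left_idealI)
    fix a b assume "a \<in> \<Union> C" "b \<in> \<Union> C"
    then obtain I K where IK: "I \<in> C" "K \<in> C" "a \<in> I" "b \<in> K" by blast
    then have "I \<subseteq> K \<or> K \<subseteq> I"
      using chain unfolding subset.chain_def by blast
    then obtain L where "L \<in> C" "a \<in> L" "b \<in> L"
      using IK by blast
    then show "a \<oplus> b \<in> \<Union> C"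
      using left_ideal.left_ideal_closed(3)[OF ideal] by blast
  next
    show "\<Union> C \<subseteq> carrier R"
      using left_ideal.left_ideal_closed(1)[OF ideal] by blast
    show "\<zero> \<in> \<Union> C"
      using left_ideal.left_ideal_closed(2)[OF ideal] \<open>C \<noteq> {}\<close> by blast
    show "x \<otimes> a \<in> \<Union> C" if "a \<in> \<Union> C" "x \<in> carrier R" for a x
      using left_ideal.left_ideal_closed(4)[OF ideal] that by blast
  qed
qed

text \<open>Properness of a left ideal means that it omits \<open>\<one>\<close>, a condition preserved by unions of
  chains; so Zorn's lemma applies.\<close>

lemma maximal_left_ideal_above:
  assumes L: "left_ideal L R" and "\<one> \<notin> L"
  obtains M where "maximal_left_ideal M R" "L \<subseteq> M"
proof -
  define A where "A = {I. left_ideal I R \<and> L \<subseteq> I \<and> \<one> \<notin> I}"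
  have "\<exists>M\<in>A. \<forall>I\<in>A. M \<subseteq> I \<longrightarrow> I = M"
  proof (rule subset_Zorn_nonempty)
    show "A \<noteq> {}"
      using assms by (auto simp: A_def)
    fix C assume C: "C \<noteq> {}" "subset.chain A C"
    then have "left_ideal (\<Union> C) R"
      by (rule left_ideal_Union_chain) (simp add: A_def)
    then show "\<Union> C \<in> A"
      using C unfolding A_def subset.chain_def by blast
  qed
  then obtain M where MA: "M \<in> A" and maxA: "\<forall>I\<in>A. M \<subseteq> I \<longrightarrow> I = M" ..
  have M: "left_ideal M R" "L \<subseteq> M" "\<one> \<notin> M"
    using MA by (simp_all add: A_def)
  have max: "I = M" if "left_ideal I R" "L \<subseteq> I" "\<one> \<notin> I" "M \<subseteq> I" for I
    using maxA that by (simp add: A_def)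
  have "maximal_left_ideal M R"
  proof (intro maximal_left_ideal.intro maximal_left_ideal_axioms.intro M(1))
    show "carrier R \<noteq> M"
      using M(3) by auto
    show "I = M \<or> I = carrier R" if "left_ideal I R" "M \<subseteq> I" for I
      using max[OF that(1)] left_ideal_eq_carrier_iff[OF that(1)] that(2) M(2) by auto
  qed
  then show thesis
    using that M(2) by blast
qed

lemma jacobson_radical_l_closed:
  assumes "x \<in> jacobson_radical R" "r \<in> carrier R"
  shows "r \<otimes> x \<in> jacobson_radical R"
proof -
  have "r \<otimes> x \<in> I" if I: "maximal_left_ideal I R" for I
  proof -
    have "x \<in> I"
      using I assms(1) by (simp add: jacobson_radical_def)
    then show ?thesis
      by (rule left_ideal.l_closed[OF maximal_left_ideal.axioms(1)[OF I] _ assms(2)])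
  qed
  then show ?thesis
    using assms by (simp add: jacobson_radical_def)
qed

lemma idempotent_in_jacobson_radical:
  assumes f: "f \<in> jacobson_radical R" and idem: "f \<otimes> f = f"
  shows "f = \<zero>"
proof (rule ccontr)
  assume "f \<noteq> \<zero>"
  have fR [simp]: "f \<in> carrier R"
    using f by (simp add: jacobson_radical_def)
  define L where "L = (\<lambda>s. s \<otimes> (\<one> \<ominus> f)) ` carrier R"
  have L: "left_ideal L R"
  proof (rule left_idealI)
    have "\<zero> \<otimes> (\<one> \<ominus> f) = \<zero>" by simp
    then show "\<zero> \<in> L"
      unfolding L_def by (metis imageI zero_closed)
  next
    fix a b assume "a \<in> L" "b \<in> L"
    then obtain s t where st: "s \<in> carrier R" "t \<in> carrier R"
      "a = s \<otimes> (\<one> \<ominus> f)" "b = t \<otimes> (\<one> \<ominus> f)"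
      unfolding L_def by auto
    then have "a \<oplus> b = (s \<oplus> t) \<otimes> (\<one> \<ominus> f)"
      by (simp add: l_distr)
    then show "a \<oplus> b \<in> L"
      using st unfolding L_def by simp
  next
    fix a x assume x: "x \<in> carrier R" and "a \<in> L"
    then obtain s where s: "s \<in> carrier R" "a = s \<otimes> (\<one> \<ominus> f)"
      unfolding L_def by auto
    then have "x \<otimes> a = (x \<otimes> s) \<otimes> (\<one> \<ominus> f)"
      using x by (simp add: m_assoc)
    then show "x \<otimes> a \<in> L"
      using s x unfolding L_def by simp
  qed (auto simp: L_def)
  have "(\<one> \<ominus> f) \<otimes> f = \<zero>"
    by (simp add: minus_eq l_distr l_minus idem r_neg)
  \<comment> \<open>So right multiplication by \<open>f\<close> annihilates all of \<open>L\<close>, but not \<open>\<one>\<close>.\<close>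
  then have "s \<otimes> (\<one> \<ominus> f) \<otimes> f = \<zero>" if "s \<in> carrier R" for s
    using that by (simp add: m_assoc)
  then have "t \<otimes> f = \<zero>" if "t \<in> L" for t
    using that unfolding L_def by auto
  then have "\<one> \<notin> L"
    using \<open>f \<noteq> \<zero>\<close> by force
  then obtain M where M: "maximal_left_ideal M R" "L \<subseteq> M"
    using maximal_left_ideal_above L by blast
  interpret M: maximal_left_ideal M R by (rule M(1))
  have "\<one> \<otimes> (\<one> \<ominus> f) \<in> L"
    unfolding L_def by blast
  then have "\<one> \<ominus> f \<in> M"
    using M(2) by auto
  moreover have "f \<in> M"
    using f M(1) by (simp add: jacobson_radical_def)
  ultimately have "(\<one> \<ominus> f) \<oplus> f \<in> M"
    by (rule M.left_ideal_closed(3))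
  then have "\<one> \<in> M"
    by (simp add: minus_eq a_assoc l_neg)
  then show False
    using left_ideal_eq_carrier_iff[OF M.left_ideal_axioms] M.I_notcarr by simp
qed

end

section \<open>Homomorphic images\<close>

context ring_hom_ring
begin

lemma left_ideal_vimage:
  assumes "left_ideal I S"
  shows "left_ideal {r \<in> carrier R. h r \<in> I} R"
  by (rule R.left_idealI) (simp_all add: left_ideal.left_ideal_closed[OF assms] subsetI)

lemma left_ideal_image:
  assumes surj: "h ` carrier R = carrier S" and K: "left_ideal K R"
  shows "left_ideal (h ` K) S"
proof (rule S.left_idealI)
  note K_closed = left_ideal.left_ideal_closed[OF K]
  show "h ` K \<subseteq> carrier S"
    using K_closed(1) by auto
  show "\<zero>\<^bsub>S\<^esub> \<in> h ` K"
    using K_closed(2) hom_zero by (metis imageI)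
  show "a \<oplus>\<^bsub>S\<^esub> b \<in> h ` K" if ab: "a \<in> h ` K" "b \<in> h ` K" for a b
  proof -
    obtain r s where rs: "r \<in> K" "s \<in> K" "a = h r" "b = h s"
      using ab by auto
    then have "a \<oplus>\<^bsub>S\<^esub> b = h (r \<oplus> s)"
      using hom_add[of r s] K_closed(1) by (simp add: subset_iff)
    then show ?thesis
      using K_closed(3) rs by blast
  qed
  show "x \<otimes>\<^bsub>S\<^esub> a \<in> h ` K" if xa: "a \<in> h ` K" "x \<in> carrier S" for a x
  proof -
    obtain r where r: "r \<in> K" "a = h r"
      using xa by auto
    obtain t where t: "t \<in> carrier R" "x = h t"
      using xa surj by (metis imageE)
    have "x \<otimes>\<^bsub>S\<^esub> a = h (t \<otimes> r)"
      using K_closed(1) r t by auto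
    then show ?thesis
      using K_closed(4) r t by blast
  qed
qed

text \<open>A left ideal above the preimage of \<open>I\<close> contains the kernel of \<open>h\<close>, so it is determined by
  its image, which by maximality of \<open>I\<close> is either \<open>I\<close> or everything.\<close>

lemma maximal_left_ideal_vimage:
  assumes surj: "h ` carrier R = carrier S" and I: "maximal_left_ideal I S"
  shows "maximal_left_ideal {r \<in> carrier R. h r \<in> I} R"
proof -
  interpret I: maximal_left_ideal I S by (rule I)
  let ?V = "{r \<in> carrier R. h r \<in> I}"
  show ?thesis
  proof (intro maximal_left_ideal.intro maximal_left_ideal_axioms.intro
      left_ideal_vimage I.left_ideal_axioms)
    have "\<one>\<^bsub>S\<^esub> \<notin> I"
      using S.left_ideal_eq_carrier_iff[OF I.left_ideal_axioms] I.I_notcarr by simp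
    then show "carrier R \<noteq> ?V"
      using hom_one R.one_closed by force
  next
    fix K assume K: "left_ideal K R" "?V \<subseteq> K" "K \<subseteq> carrier R"
    have "I \<subseteq> h ` K"
    proof
      fix a assume a: "a \<in> I"
      then have "a \<in> h ` carrier R"
        using surj I.left_ideal_closed(1) by blast
      then show "a \<in> h ` K"
        using a K(2) by auto
    qed
    moreover have hK: "left_ideal (h ` K) S"
      using left_ideal_image[OF surj] K(1) .
    ultimately consider "h ` K = I" | "h ` K = carrier S"
      using I.I_maximal left_ideal.left_ideal_closed(1)[OF hK] by blast
    then show "K = ?V \<or> K = carrier R"
    proof cases
      case 1
      then show ?thesis
        using K by auto
    next
      case 2
      then obtain s where s: "s \<in> K" "h s = \<one>\<^bsub>S\<^esub>"
        using S.one_closed by (metis imageE)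
      have sR: "s \<in> carrier R"
        using s K(3) by auto
      \<comment> \<open>\<open>\<one> - s\<close> is in the kernel of \<open>h\<close>, hence in the preimage of \<open>I\<close>, hence in \<open>K\<close>.\<close>
      have "h (\<one> \<ominus> s) = \<zero>\<^bsub>S\<^esub>"
        using s sR by (simp add: R.minus_eq S.r_neg)
      then have "\<one> \<ominus> s \<in> K"
        using K(2) sR I.left_ideal_closed(2) by auto
      then have "(\<one> \<ominus> s) \<oplus> s \<in> K"
        using s left_ideal.left_ideal_closed(3)[OF K(1)] by blast
      then have "\<one> \<in> K"
        using sR by (simp add: R.minus_eq R.a_assoc R.l_neg)
      then show ?thesis
        using R.left_ideal_eq_carrier_iff[OF K(1)] by simp
    qed
  qed
qed

lemma sqrt_jacobson_radical_image:
  assumes surj: "h ` carrier R = carrier S" and z: "z \<in> sqrt_jacobson_radical R"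
  shows "h z \<in> sqrt_jacobson_radical S"
proof -
  have J: "h x \<in> jacobson_radical S" if "x \<in> jacobson_radical R" for x
    using that maximal_left_ideal_vimage[OF surj] by (auto simp: jacobson_radical_def)
  obtain k :: nat where k: "z \<in> carrier R" "k \<ge> 1" "z [^] k \<in> jacobson_radical R"
    using z by (auto simp: sqrt_jacobson_radical_def)
  have "h (z [^] k) = h z [^]\<^bsub>S\<^esub> k"
    using k(1) by (induction k) auto
  then show ?thesis
    using J[OF k(3)] k by (auto simp: sqrt_jacobson_radical_def)
qed

lemma strongly_sqrtJ_clean_image:
  assumes surj: "h ` carrier R = carrier S" and "\<one>\<^bsub>S\<^esub> \<noteq> \<zero>\<^bsub>S\<^esub>"
    and clean: "strongly_sqrtJ_clean_ring R"
  shows "strongly_sqrtJ_clean_ring S"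
proof (intro strongly_sqrtJ_clean_ring.intro strongly_sqrtJ_clean_ring_axioms.intro
    S.ring_axioms assms(2))
  fix x assume "x \<in> carrier S"
  then obtain r where r: "r \<in> carrier R" "x = h r"
    using surj by (metis imageE)
  obtain e z where ez: "e \<in> carrier R" "z \<in> sqrt_jacobson_radical R"
    "r = e \<oplus> z" "e \<otimes> e = e" "e \<otimes> z = z \<otimes> e"
    using strongly_sqrtJ_clean_ring.strongly_clean[OF clean r(1)] by blast
  have "z \<in> carrier R"
    using ez(2) by (simp add: sqrt_jacobson_radical_def)
  then have "x = h e \<oplus>\<^bsub>S\<^esub> h z \<and> h e \<otimes>\<^bsub>S\<^esub> h e = h e \<and> h e \<otimes>\<^bsub>S\<^esub> h z = h z \<otimes>\<^bsub>S\<^esub> h e"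
    using ez r by (metis hom_add hom_mult)
  moreover have "h e \<in> carrier S" "h z \<in> sqrt_jacobson_radical S"
    using ez(1,2) sqrt_jacobson_radical_image[OF surj] by auto
  ultimately show "\<exists>e\<in>carrier S. \<exists>z\<in>sqrt_jacobson_radical S.
      x = e \<oplus>\<^bsub>S\<^esub> z \<and> e \<otimes>\<^bsub>S\<^esub> e = e \<and> e \<otimes>\<^bsub>S\<^esub> z = z \<otimes>\<^bsub>S\<^esub> e"
    by blast
qed

end

section \<open>Units of strongly clean rings\<close>

context strongly_sqrtJ_clean_ring
begin

text \<open>The complement \<open>f = \<one> - e\<close> of the idempotent part of \<open>u\<close> commutes with everything in sight
  and satisfies \<open>f u = f z\<close>, whence \<open>f u\<^sup>k = f z\<^sup>k\<close> for all \<open>k\<close>. Cancelling \<open>u\<^sup>k\<close> puts \<open>f\<close> into the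
  radical.\<close>

lemma unit_minus_one_in_sqrtJ:
  assumes u: "u \<in> Units R"
  shows "u \<ominus> \<one> \<in> sqrt_jacobson_radical R"
proof -
  have uR [simp]: "u \<in> carrier R"
    using u by blast
  obtain e z where e [simp]: "e \<in> carrier R" and z: "z \<in> sqrt_jacobson_radical R"
    and u_eq: "u = e \<oplus> z" and ee: "e \<otimes> e = e" and comm: "e \<otimes> z = z \<otimes> e"
    using strongly_clean[OF uR] by blast
  obtain k :: nat where zR [simp]: "z \<in> carrier R" and zk: "z [^] k \<in> jacobson_radical R"
    using z by (auto simp: sqrt_jacobson_radical_def)
  define f where "f = \<one> \<ominus> e"
  have f [simp]: "f \<in> carrier R"
    by (simp add: f_def)
  have fe: "f \<otimes> e = \<zero>" and ef: "e \<otimes> f = \<zero>"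
    by (simp_all add: f_def minus_eq l_distr r_distr l_minus r_minus ee r_neg)
  have ff: "f \<otimes> f = f"
  proof -
    have "f \<otimes> f = f \<ominus> e \<otimes> f"
      by (subst (1) f_def) (simp add: minus_eq l_distr l_minus)
    then show ?thesis
      by (simp add: ef minus_eq)
  qed
  have fz: "f \<otimes> z = z \<otimes> f"
    by (simp add: f_def minus_eq l_distr r_distr l_minus r_minus comm)
  have fu_fz: "f \<otimes> u = f \<otimes> z"
    by (simp add: u_eq r_distr fe)
  have fu: "u \<otimes> f = f \<otimes> u"
    by (simp add: u_eq r_distr l_distr fe ef fz)
  have pow_f: "u [^] j \<otimes> f = f \<otimes> u [^] j" for j :: nat
    by (rule group_commutes_pow) (auto simp: fu)
  have pow: "f \<otimes> z [^] j = f \<otimes> u [^] j" for j :: nat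
  proof (induction j)
    case (Suc j)
    have "f \<otimes> z [^] Suc j = (f \<otimes> z [^] j) \<otimes> z"
      by (simp add: m_assoc)
    also have "\<dots> = u [^] j \<otimes> (f \<otimes> z)"
      by (simp add: Suc m_assoc flip: pow_f)
    also have "\<dots> = f \<otimes> u [^] Suc j"
      by (simp add: pow_f flip: fu_fz m_assoc)
    finally show ?case .
  qed simp
  have v [simp]: "inv u \<in> carrier R"
    using u by simp
  have "inv u [^] k \<otimes> u [^] k = (inv u \<otimes> u) [^] k"
    using u by (intro pow_mult_distrib[symmetric]) auto
  then have cancel: "inv u [^] k \<otimes> u [^] k = \<one>"
    using u by simp
  have "inv u [^] k \<otimes> (f \<otimes> z [^] k) = inv u [^] k \<otimes> u [^] k \<otimes> f"
    by (simp add: pow m_assoc flip: pow_f)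
  also have "\<dots> = f"
    by (simp add: cancel)
  finally have "f \<in> jacobson_radical R"
    using jacobson_radical_l_closed[OF jacobson_radical_l_closed[OF zk]] by (metis f v nat_pow_closed)
  then have "f = \<zero>"
    using ff by (rule idempotent_in_jacobson_radical)
  moreover have "f \<oplus> e = \<one>"
    by (simp add: f_def minus_eq a_assoc l_neg)
  ultimately have "e = \<one>"
    by simp
  then have "u \<ominus> \<one> = z"
    by (simp add: u_eq minus_eq a_ac r_neg)
  then show ?thesis
    using z by simp
qed

text \<open>The hypotheses say that \<open>E\<close> is the identity of a corner of the ring in which
  \<open>y\<close> and \<open>E + y\<close> are inverse to each other. In the whole ring \<open>\<one> + y\<close> is then a unit, with
  inverse \<open>\<one> - E + y\<close>, so \<open>y\<close> has a power in the radical; as \<open>y\<close> is invertible in the corner,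
  \<open>E\<close> is in the radical, too.\<close>

lemma corner_unit_relation_trivial:
  assumes y [simp]: "y \<in> carrier R" and E_eq: "y \<otimes> y \<oplus> y = E" and Ey: "E \<otimes> y = y"
  shows "y = \<zero>"
proof -
  have E [simp]: "E \<in> carrier R"
    using E_eq by auto
  have yE: "y \<otimes> E = y"
  proof -
    have "y \<otimes> E = E \<otimes> y"
      by (simp flip: E_eq add: l_distr r_distr m_assoc)
    then show ?thesis
      using Ey by simp
  qed
  have EE: "E \<otimes> E = E"
  proof -
    have "E \<otimes> E = E \<otimes> y \<otimes> y \<oplus> E \<otimes> y"
      by (subst (2) E_eq[symmetric]) (simp add: r_distr m_assoc)
    then show ?thesis
      by (simp add: Ey E_eq)
  qed
  let ?v = "\<one> \<ominus> E \<oplus> y"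
  have vE: "y \<oplus> ?v \<otimes> y = E" "y \<oplus> y \<otimes> ?v = E"
    by (simp_all add: minus_eq l_distr r_distr l_minus r_minus Ey yE r_neg)
       (simp_all add: a_comm flip: E_eq)
  have v_alt: "(\<one> \<ominus> E) \<oplus> E = \<one>"
    by (simp add: minus_eq a_assoc l_neg)
  have "?v \<otimes> (\<one> \<oplus> y) = (\<one> \<ominus> E) \<oplus> (y \<oplus> ?v \<otimes> y)"
    by (simp add: r_distr a_assoc)
  then have left: "?v \<otimes> (\<one> \<oplus> y) = \<one>"
    by (simp only: vE v_alt)
  have "(\<one> \<oplus> y) \<otimes> ?v = (\<one> \<ominus> E) \<oplus> (y \<oplus> y \<otimes> ?v)"
    by (simp add: l_distr a_assoc)
  then have right: "(\<one> \<oplus> y) \<otimes> ?v = \<one>"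
    by (simp only: vE v_alt)
  have "\<one> \<oplus> y \<in> Units R"
    unfolding Units_def using left right by (auto intro!: bexI[of _ ?v])
  then have "(\<one> \<oplus> y) \<ominus> \<one> \<in> sqrt_jacobson_radical R"
    by (rule unit_minus_one_in_sqrtJ)
  moreover have "(\<one> \<oplus> y) \<ominus> \<one> = y"
    by (simp add: minus_eq a_ac r_neg)
  ultimately obtain k :: nat where k: "k \<ge> 1" "y [^] k \<in> jacobson_radical R"
    by (auto simp: sqrt_jacobson_radical_def)
  have E_eq': "y \<oplus> y \<otimes> y = E"
    using E_eq by (simp add: a_comm)
  have inverse: "(E \<oplus> y) \<otimes> y = E" "y \<otimes> (E \<oplus> y) = E"
    by (simp_all add: l_distr r_distr Ey yE E_eq')
  have "(E \<oplus> y) [^] k \<otimes> y [^] k = ((E \<oplus> y) \<otimes> y) [^] k"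
    by (intro pow_mult_distrib[symmetric]) (auto simp: inverse)
  also have "\<dots> = E [^] k"
    by (simp add: inverse)
  also have "\<dots> = E"
    using k(1) by (induction k rule: dec_induct) (auto simp: EE)
  finally have "E \<in> jacobson_radical R"
    using jacobson_radical_l_closed[OF k(2)] by (metis E y a_closed nat_pow_closed)
  then have "E = \<zero>"
    using EE by (rule idempotent_in_jacobson_radical)
  then show ?thesis
    using Ey by simp
qed

end

section \<open>Matrix rings\<close>

lemma (in ring) finsum_first_two:
  assumes "n \<ge> 2" and g: "\<And>k. k < n \<Longrightarrow> g k \<in> carrier R"
    and "\<And>k. 2 \<le> k \<Longrightarrow> k < n \<Longrightarrow> g k = \<zero>"
  shows "(\<Oplus>k\<in>{..<n}. g k) = g 0 \<oplus> g (1::nat)"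
proof -
  have "(\<Oplus>k\<in>{..<n}. g k) = (\<Oplus>k\<in>{0,1}. g k)"
    using assms by (intro add.finprod_mono_neutral_cong_left[symmetric]) auto
  also have "\<dots> = g 0 \<oplus> g 1"
    using assms by simp
  finally show ?thesis .
qed

lemma (in ring) matrix_ring_not_strongly_sqrtJ_clean:
  assumes "\<one> \<noteq> \<zero>" "n \<ge> 2"
  shows "\<not> strongly_sqrtJ_clean_ring (matrix_ring R n)"
proof
  assume "strongly_sqrtJ_clean_ring (matrix_ring R n)"
  then interpret M: strongly_sqrtJ_clean_ring "matrix_ring R n" .
  \<comment> \<open>The entries of the corner matrix with rows \<open>(0, 1)\<close> and \<open>(1, -1)\<close>, and of the corner identity.\<close>
  define yc :: "nat \<Rightarrow> nat \<Rightarrow> 'a" where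
    "yc i j = (if i = 0 \<and> j = 1 \<or> i = 1 \<and> j = 0 then \<one> else if i = 1 \<and> j = 1 then \<ominus> \<one> else \<zero>)" for i j
  define ec :: "nat \<Rightarrow> nat \<Rightarrow> 'a" where
    "ec i j = (if i = j \<and> i < 2 then \<one> else \<zero>)" for i j
  have carr [simp]: "yc i j \<in> carrier R" "ec i j \<in> carrier R" for i j
    by (auto simp: yc_def ec_def)
  let ?y = "mat n n (\<lambda>(i, j). yc i j)" and ?E = "mat n n (\<lambda>(i, j). ec i j)"
  have yy: "(\<Oplus>k\<in>{..<n}. yc i k \<otimes> yc k j) \<oplus> yc i j = ec i j" for i j
  proof -
    have "(\<Oplus>k\<in>{..<n}. yc i k \<otimes> yc k j) = yc i 0 \<otimes> yc 0 j \<oplus> yc i 1 \<otimes> yc 1 j"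
      using assms by (intro finsum_first_two) (auto simp: yc_def)
    then show ?thesis
      by (auto simp: yc_def ec_def l_minus r_minus a_assoc r_neg l_neg)
  qed
  have ey: "(\<Oplus>k\<in>{..<n}. ec i k \<otimes> yc k j) = yc i j" for i j
  proof -
    have "(\<Oplus>k\<in>{..<n}. ec i k \<otimes> yc k j) = ec i 0 \<otimes> yc 0 j \<oplus> ec i 1 \<otimes> yc 1 j"
      using assms by (intro finsum_first_two) (auto simp: ec_def)
    then show ?thesis
      by (auto simp: yc_def ec_def)
  qed
  have mult: "mat n n (\<lambda>(i, j). a i j) \<otimes>\<^bsub>matrix_ring R n\<^esub> mat n n (\<lambda>(i, j). b i j)
      = mat n n (\<lambda>(i, j). \<Oplus>k\<in>{..<n}. a i k \<otimes> b k j)"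
    if "\<And>i j. a i j \<in> carrier R" "\<And>i j. b i j \<in> carrier R" for a b
    using that by (auto simp: matrix_ring_def intro!: eq_matI finsum_cong')
  have "?y = \<zero>\<^bsub>matrix_ring R n\<^esub>"
  proof (rule M.corner_unit_relation_trivial)
    show "?y \<in> carrier (matrix_ring R n)"
      by (simp add: matrix_ring_def)
    have "?y \<otimes>\<^bsub>matrix_ring R n\<^esub> ?y \<oplus>\<^bsub>matrix_ring R n\<^esub> ?y
        = mat n n (\<lambda>(i, j). (\<Oplus>k\<in>{..<n}. yc i k \<otimes> yc k j) \<oplus> yc i j)"
      by (subst mult) (auto simp: matrix_ring_def)
    then show "?y \<otimes>\<^bsub>matrix_ring R n\<^esub> ?y \<oplus>\<^bsub>matrix_ring R n\<^esub> ?y = ?E"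
      by (simp only: yy)
    show "?E \<otimes>\<^bsub>matrix_ring R n\<^esub> ?y = ?y"
      by (subst mult) (simp_all add: ey)
  qed
  then have "?y $$ (0, 1) = \<zero>\<^bsub>matrix_ring R n\<^esub> $$ (0, 1)"
    by simp
  then show False
    using assms by (simp add: matrix_ring_def yc_def)
qed

lemma (in ring) scalar_ring_hom:
  "ring_hom_ring R (matrix_ring R 1) (\<lambda>r. mat 1 1 (\<lambda>_. r))"
proof (rule ring_hom_ringI)
  show "ring R" by (rule ring_axioms)
  show "ring (matrix_ring R 1)"
    by (rule ring_matrix_ring) (rule ring_axioms)
next
  fix x y assume xy: "x \<in> carrier R" "y \<in> carrier R"
  have "{..<1::nat} = {0}"
    by auto
  then have "(\<Oplus>k\<in>{..<1}. mat 1 1 (\<lambda>_. x) $$ (0, k) \<otimes> mat 1 1 (\<lambda>_. y) $$ (k, 0)) = x \<otimes> y"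
    using xy by simp
  then show "mat 1 1 (\<lambda>_. x \<otimes> y)
      = mat 1 1 (\<lambda>_. x) \<otimes>\<^bsub>matrix_ring R 1\<^esub> mat 1 1 (\<lambda>_. y)"
    by (auto simp: matrix_ring_def intro!: eq_matI)
qed (auto simp: matrix_ring_def intro!: eq_matI)

lemma (in ring) scalar_surj:
  "(\<lambda>r. mat 1 1 (\<lambda>_. r)) ` carrier R = carrier (matrix_ring R 1)"
proof -
  have "A = mat 1 1 (\<lambda>_. A $$ (0, 0))" if "A \<in> carrier (matrix_ring R 1)" for A
    using that by (auto simp: matrix_ring_def intro!: eq_matI)
  moreover have "A $$ (0, 0) \<in> carrier R" if "A \<in> carrier (matrix_ring R 1)" for A
    using that by (simp add: matrix_ring_def)
  ultimately have "carrier (matrix_ring R 1) \<subseteq> (\<lambda>r. mat 1 1 (\<lambda>_. r)) ` carrier R"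
    by blast
  then show ?thesis
    by (auto simp: matrix_ring_def)
qed

theorem lemma5p1:
  fixes R :: "('a, 'b) ring_scheme" and n :: nat
  assumes "strongly_sqrtJ_clean_ring R" and "n \<ge> 1"
  shows "strongly_sqrtJ_clean_ring (matrix_ring R n) \<longleftrightarrow> n = 1"
proof
  interpret strongly_sqrtJ_clean_ring R by (rule assms(1))
  show "n = 1" if "strongly_sqrtJ_clean_ring (matrix_ring R n)"
    using that matrix_ring_not_strongly_sqrtJ_clean[OF one_not_zero, of n] assms(2) by linarith
  have "strongly_sqrtJ_clean_ring (matrix_ring R 1)"
    using ring_hom_ring.strongly_sqrtJ_clean_image[OF scalar_ring_hom scalar_surj
        matrix_ring_one_not_zero[OF one_not_zero] assms(1)] by simp
  then show "strongly_sqrtJ_clean_ring (matrix_ring R n)" if "n = 1"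
    using that by simp
qed

end
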